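(* Let $N\ge 5$ be an integer. The Poisson brackets $\{\cdot,\cdot\}_{\mathcal{C}_{2,N}}$ and $\{\cdot,\cdot\}_{S2}$ on the field of rational functions $\mathbb{R}(B_1,\dots,B_N)$ are compatible; that is, for every $\lambda\in\mathbb{R}$ the bracket $\{\cdot,\cdot\}_{\mathcal{C}_{2,N}}+\lambda\{\cdot,\cdot\}_{S2}$ is a Poisson bracket on $\mathbb{R}(B_1,\dots,B_N)$.
   Context: $B_1,\dots,B_N$ are algebraically independent variables (geometrically they are the cross-ratio coordinates on the configuration space $\mathcal{C}_{2,N}$ of $N$-twisted polygons in $\mathbb{RP}^1$). Indices are read modulo $N$, so $B_{k+N}=B_k$. A Poisson bracket on a commutative $\mathbb{R}$-algebra is an $\mathbb{R}$-bilinear antisymmetric bracket satisfying Leibniz's rule in each argument and the Jacobi identity. The bracket $\{\cdot,\cdot\}_{\mathcal{C}_{2,N}}$ is the antisymmetric biderivation of $\mathbb{R}(B_1,\dots,B_N)$ determined by $$\{B_k,B_{k+1}\}_{\mathcal{C}_{2,N}}=\Bigl(1-\frac1{B_k}-\frac1{B_{k+1}}\Bigr)B_kB_{k+1},\qquad \{B_k,B_{k+2}\}_{\mathcal{C}_{2,N}}=-\frac{B_kB_{k+2}}{B_{k+1}}\qquad (k=1,\dots,N),$$ by antisymmetry (which gives $\{B_k,B_{k-1}\}$ and $\{B_k,B_{k-2}\}$), and by $\{B_i,B_j\}_{\mathcal{C}_{2,N}}=0$ whenever $i-j\not\equiv \pm1,\pm2 \pmod N$. The bracket $\{\cdot,\cdot\}_{S2}$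 is the antisymmetric biderivation of $\mathbb{R}(B_1,\dots,B_N)$ determined by $$\{B_i,B_j\}_{S2}=(\delta_{i+1,j}-\delta_{i-1,j})\,B_iB_j,$$ where $\delta$ is the Kronecker delta with indices modulo $N$. *)

theory Defs
  imports
    "HOL-Library.Poly_Mapping"
    "HOL-Computational_Algebra.Fraction_Field"
    "Berlekamp_Zassenhaus.Finite_Field"
begin

text \<open>
  The indices live in the ring of integers modulo \<open>N = CARD('n)\<close>, that is, in the type
  \<open>'n mod_ring\<close>. An (arbitrary) linear order on the indices, unrelated to the cyclic structure,
  is needed only because the library instance of class \<open>idom\<close> for polynomials asks for one.
\<close>

instantiation mod_ring :: (finite) linorder
begin

definition less_eq_mod_ring :: "'a mod_ring \<Rightarrow> 'a mod_ring \<Rightarrow> bool"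
  where "x \<le> y \<longleftrightarrow> to_int_mod_ring x \<le> to_int_mod_ring y"

definition less_mod_ring :: "'a mod_ring \<Rightarrow> 'a mod_ring \<Rightarrow> bool"
  where "x < y \<longleftrightarrow> to_int_mod_ring x < to_int_mod_ring y"

instance
  by standard (auto simp: less_eq_mod_ring_def less_mod_ring_def)

end

text \<open>
  Monomials are finitely supported exponent functions \<open>'n mod_ring \<Rightarrow>\<^sub>0 nat\<close>, real polynomials in
  \<open>N\<close> variables are finitely supported coefficient functions on monomials, and \<open>'n ratfun\<close> is
  the field of fractions of that polynomial ring.
\<close>

type_synonym 'n ratfun = "(('n mod_ring \<Rightarrow>\<^sub>0 nat) \<Rightarrow>\<^sub>0 real) fract"

definition const :: "real \<Rightarrow> 'n::finite ratfun"
  where "const c = Fract (Poly_Mapping.single 0 c) 1"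

definition B :: "'n mod_ring \<Rightarrow> 'n::finite ratfun"
  where "B k = Fract (Poly_Mapping.single (Poly_Mapping.single k 1) 1) 1"

type_synonym 'n bracket = "'n ratfun \<Rightarrow> 'n ratfun \<Rightarrow> 'n ratfun"

definition real_bilinear :: "'n::finite bracket \<Rightarrow> bool"
  where "real_bilinear br \<longleftrightarrow>
    (\<forall>f g h. br (f + g) h = br f h + br g h) \<and>
    (\<forall>f g h. br f (g + h) = br f g + br f h) \<and>
    (\<forall>c f g. br (const c * f) g = const c * br f g) \<and>
    (\<forall>c f g. br f (const c * g) = const c * br f g)"

definition antisymmetric :: "'n::finite bracket \<Rightarrow> bool"
  where "antisymmetric br \<longleftrightarrow> (\<forall>f g. br f g = - br g f)"

definition leibniz :: "'n::finite bracket \<Rightarrow> bool"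
  where "leibniz br \<longleftrightarrow>
    (\<forall>f g h. br (f * g) h = f * br g h + br f h * g) \<and>
    (\<forall>f g h. br f (g * h) = br f g * h + g * br f h)"

definition jacobi :: "'n::finite bracket \<Rightarrow> bool"
  where "jacobi br \<longleftrightarrow> (\<forall>f g h. br f (br g h) + br g (br h f) + br h (br f g) = 0)"

definition antisymmetric_biderivation :: "'n::finite bracket \<Rightarrow> bool"
  where "antisymmetric_biderivation br \<longleftrightarrow> real_bilinear br \<and> antisymmetric br \<and> leibniz br"

definition poisson_bracket :: "'n::finite bracket \<Rightarrow> bool"
  where "poisson_bracket br \<longleftrightarrow>
    real_bilinear br \<and> antisymmetric br \<and> leibniz br \<and> jacobi br"

text \<open>
  The two brackets are introduced by definite description. The prescribed values are consistent
  for \<open>N \<ge> 5\<close>, where \<open>1, -1, 2, -2\<close> are pairwise distinct modulo \<open>N\<close>; for smaller \<open>N\<close> the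
  description of \<open>bracket_C2\<close> need not denote anything meaningful.
\<close>

definition bracket_C2 :: "'n::nontriv bracket"
  where "bracket_C2 = (THE br. antisymmetric_biderivation br \<and>
    (\<forall>k. br (B k) (B (k + 1)) = (1 - 1 / B k - 1 / B (k + 1)) * B k * B (k + 1)) \<and>
    (\<forall>k. br (B k) (B (k + 2)) = - (B k * B (k + 2) / B (k + 1))) \<and>
    (\<forall>i j. i - j \<notin> {1, -1, 2, -2} \<longrightarrow> br (B i) (B j) = 0))"

definition kronecker_delta :: "'n mod_ring \<Rightarrow> 'n mod_ring \<Rightarrow> 'n::finite ratfun"
  where "kronecker_delta i j = (if i = j then 1 else 0)"

definition bracket_S2 :: "'n::nontriv bracket"
  where "bracket_S2 = (THE br. antisymmetric_biderivation br \<and>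
    (\<forall>i j. br (B i) (B j) =
      (kronecker_delta (i + 1) j - kronecker_delta (i - 1) j) * B i * B j))"

definition compatible :: "'n::finite bracket \<Rightarrow> 'n bracket \<Rightarrow> bool"
  where "compatible br1 br2 \<longleftrightarrow>
    (\<forall>c::real. poisson_bracket (\<lambda>f g. br1 f g + const c * br2 f g))"

end

theory Submission
  imports Defs
begin

text \<open>
  In the logarithmic coordinates \<open>u\<^sub>i = ln B\<^sub>i\<close> both brackets become simple:
  \<open>{u\<^sub>i, u\<^sub>j}\<close> is constant for the second bracket and a constant plus a linear form in the
  \<open>x\<^sub>m = 1/B\<^sub>m\<close> for the first one. Moreover the constant part of the first bracket is
  the second bracket. So the pencil of the two brackets consists of the brackets with
  \<open>{u\<^sub>i, u\<^sub>j} = c \<cdot> a\<^sub>i\<^sub>j - \<Sum>\<^sub>m T\<^sub>m(i,j) \<cdot> x\<^sub>m\<close>, where \<open>c = 1 + \<lambda>\<close>, the form \<open>a\<close> pairs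
  neighbours (\<open>neighbour_form\<close>) and, with \<open>e\<^sub>k\<close> the indicator of the index \<open>k\<close>, the form
  \<open>T\<^sub>m = e\<^sub>m\<^sub>-\<^sub>1 \<and> e\<^sub>m + e\<^sub>m \<and> e\<^sub>m\<^sub>+\<^sub>1 + e\<^sub>m\<^sub>-\<^sub>1 \<and> e\<^sub>m\<^sub>+\<^sub>1\<close> (\<open>triple_form\<close>) lives on three
  consecutive indices. It suffices to prove the Jacobi identity for this family
  (\<open>poisson_bracket_pencil\<close>).

  The Jacobiator is a derivation in each argument, hence it may be tested on the \<open>B\<^sub>i\<close>. There,
  the terms quadratic in \<open>{u\<^sub>i, u\<^sub>j}\<close> cancel for reasons of antisymmetry alone, and what remains is
  the cyclic sum of \<open>{u\<^sub>i, {u\<^sub>j, u\<^sub>k}}\<close>. This is a polynomial of degree at most two in the \<open>x\<^sub>m\<close>. Its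
  coefficient at \<open>c x\<^sub>m\<close> is the wedge product of \<open>T\<^sub>m\<close> with the linear form
  \<open>i \<mapsto> a\<^sub>i\<^sub>m\<close>; its coefficient at \<open>x\<^sub>m x\<^sub>p\<close> is, up to sign, \<open>T\<^sub>m \<and> T\<^sub>p(\<cdot>,m) + T\<^sub>p \<and> T\<^sub>m(\<cdot>,p)\<close>.
  The first vanishes (\<open>wedge_triple_neighbour\<close>), and so does the second, because the indices
  \<open>m-1\<close>, \<open>m\<close>, \<open>m+1\<close> are distinct (\<open>wedge_triple_triple\<close>); both are identities between products
  of the \<open>e\<^sub>k\<close>, so no case distinction on the position of \<open>i, j, k\<close> on the circle is needed.

  The two brackets are given by definite descriptions. To work with them, the derivations
  \<open>B\<^sub>i \<cdot> \<partial>/\<partial>B\<^sub>i\<close> of the field are constructed, which gives an explicit bracket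
  (\<open>log_bracket\<close>) with any prescribed antisymmetric values \<open>{u\<^sub>i, u\<^sub>j}\<close>; uniqueness holds because
  a derivation is determined by its values on the \<open>B\<^sub>i\<close>.
\<close>

section \<open>Derivations of the field of rational functions\<close>

definition derivation :: "('n::finite ratfun \<Rightarrow> 'n ratfun) \<Rightarrow> bool"
  where "derivation D \<longleftrightarrow>
    (\<forall>f g. D (f + g) = D f + D g) \<and>
    (\<forall>c f. D (const c * f) = const c * D f) \<and>
    (\<forall>f g. D (f * g) = D f * g + f * D g)"

lemma const_0 [simp]: "const 0 = 0"
  by (simp add: const_def fract_collapse)

lemma const_1 [simp]: "const 1 = 1"
  by (simp add: const_def fract_collapse)

lemma two_nonzero: "(2 :: 'n::finite ratfun) \<noteq> 0"
proof -
  have two: "(2 :: 'n ratfun) = Fract 2 1"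
    using of_nat_fract[of 2] by simp
  show ?thesis
    unfolding Zero_fract_def two by (subst eq_fract) simp_all
qed

lemma B_nonzero [simp]: "B k \<noteq> 0"
proof -
  have "Poly_Mapping.single (Poly_Mapping.single k 1) (1 :: real) \<noteq> 0"
    by (metis lookup_single_eq lookup_zero zero_neq_one)
  then show ?thesis
    by (auto simp: B_def Zero_fract_def eq_fract simp del: One_nat_def)
qed

context
  fixes D :: "'n::finite ratfun \<Rightarrow> 'n ratfun"
  assumes D: "derivation D"
begin

lemma derivation_add: "D (f + g) = D f + D g"
  using D unfolding derivation_def by blast

lemma derivation_mult: "D (f * g) = D f * g + f * D g"
  using D unfolding derivation_def by blast

lemma derivation_scale: "D (const c * f) = const c * D f"
  using D unfolding derivation_def by blast

lemma derivation_1: "D 1 = 0"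
  using derivation_mult[of 1 1] by (simp only: mult_1_left mult_1_right add_cancel_right_left)

lemma derivation_const: "D (const c) = 0"
  using derivation_scale[of c 1] by (simp add: derivation_1)

lemma derivation_0: "D 0 = 0"
  using derivation_const[of 0] by simp

lemma derivation_uminus: "D (- f) = - D f"
  using derivation_add[of f "- f"] derivation_0 by (simp add: eq_neg_iff_add_eq_0 add.commute)

lemma derivation_diff: "D (f - g) = D f - D g"
  using derivation_add[of f "- g"] derivation_uminus by simp

lemma derivation_sum: "D (\<Sum>i\<in>A. f i) = (\<Sum>i\<in>A. D (f i))"
  by (induction A rule: infinite_finite_induct) (simp_all add: derivation_0 derivation_add)

lemma derivation_inverse: "f \<noteq> 0 \<Longrightarrow> D (inverse f) = - D f * inverse f * inverse f"
  using derivation_mult[of f "inverse f"] derivation_1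
  by (simp add: field_simps eq_neg_iff_add_eq_0)

end

lemma poly_mapping_induct_add [case_names single add]:
  fixes p :: "'a \<Rightarrow>\<^sub>0 'b::comm_monoid_add"
  assumes single: "\<And>k c. P (Poly_Mapping.single k c)"
    and add: "\<And>p q. P p \<Longrightarrow> P q \<Longrightarrow> P (p + q)"
  shows "P p"
proof (induction p rule: update_induct)
  case const
  show ?case
    using single[of undefined 0] by simp
next
  case (update p k c)
  have "Poly_Mapping.update k c p = p + Poly_Mapping.single k c"
    using update(1)
    by (intro poly_mapping_eqI) (auto simp: lookup_update lookup_add lookup_single in_keys_iff when_def)
  then show ?case
    using add[OF update(3) single] by simp
qed

text \<open>
  Every rational function is built from the constants and the \<open>B k\<close> by sums, products and
  quotients, so a derivation is determined by its values on the \<open>B k\<close>.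
\<close>

lemma derivation_eq_0_if_zero_on_generators:
  assumes D: "derivation D" and gen: "\<And>k. D (B k) = 0"
  shows "D f = 0"
proof -
  have single_mult: "Fract (Poly_Mapping.single (\<alpha> + \<beta>) 1) 1 =
      Fract (Poly_Mapping.single \<alpha> 1) 1 * Fract (Poly_Mapping.single \<beta> 1) (1 :: ('a mod_ring \<Rightarrow>\<^sub>0 nat) \<Rightarrow>\<^sub>0 real)" for \<alpha> \<beta>
    by (simp add: mult_single)
  have monomial: "D (Fract (Poly_Mapping.single \<alpha> 1) 1) = 0" for \<alpha>
  proof (induction \<alpha> rule: poly_mapping_induct_add)
    case (single k n)
    show ?case
    proof (induction n)
      case 0
      show ?case
        by (simp add: fract_collapse derivation_1[OF D])
    next
      case (Suc n)
      have "Poly_Mapping.single k (Suc n) = Poly_Mapping.single k 1 + Poly_Mapping.single k n"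
        by (simp flip: single_add)
      then show ?case
        using Suc by (simp only: single_mult derivation_mult[OF D] gen flip: B_def) simp
    qed
  next
    case (add \<alpha> \<beta>)
    then show ?case
      by (simp only: single_mult derivation_mult[OF D]) simp
  qed
  have polynomial: "D (Fract p 1) = 0" for p
  proof (induction p rule: poly_mapping_induct_add)
    case (single \<alpha> c)
    have "Fract (Poly_Mapping.single \<alpha> c) 1 = const c * Fract (Poly_Mapping.single \<alpha> 1) 1"
      by (simp add: const_def mult_single)
    then show ?case
      using monomial by (simp add: derivation_scale[OF D])
  next
    case (add p q)
    have "Fract (p + q) 1 = Fract p 1 + Fract q 1"
      by simp
    then show ?case
      using add by (simp only: derivation_add[OF D] add_0)
  qed
  obtain p q where f: "f = Fract p q" and q: "q \<noteq> 0"
    by (cases f)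
  have "f * Fract q 1 = Fract p 1"
    using q by (simp add: f eq_fract)
  then have "D f * Fract q 1 = 0"
    using polynomial derivation_mult[OF D, of f "Fract q 1"] by simp
  moreover have "Fract q 1 \<noteq> 0"
    using q by (simp add: Zero_fract_def eq_fract)
  ultimately show ?thesis
    by simp
qed

lemma derivation_eqI:
  assumes D: "derivation D" and D': "derivation D'" and gen: "\<And>k. D (B k) = D' (B k)"
  shows "D f = D' f"
proof -
  have "derivation (\<lambda>f. D f - D' f)"
    by (simp only: derivation_def derivation_add[OF D] derivation_add[OF D']
        derivation_mult[OF D] derivation_mult[OF D'] derivation_const[OF D] derivation_const[OF D'])
      (simp add: algebra_simps)
  then have "D f - D' f = 0"
    using derivation_eq_0_if_zero_on_generators[where D = "\<lambda>f. D f - D' f"] gen by simp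
  then show ?thesis
    by simp
qed

section \<open>Euler derivations\<close>

text \<open>
  The derivation \<open>B\<^sub>i \<cdot> \<partial>/\<partial>B\<^sub>i\<close> of the polynomial ring. Unlike the partial derivative itself it is
  diagonal on monomials, so that it needs no shift of exponents.
\<close>

definition euler_poly :: "'a \<Rightarrow> (('a \<Rightarrow>\<^sub>0 nat) \<Rightarrow>\<^sub>0 'b::comm_semiring_1) \<Rightarrow> (('a \<Rightarrow>\<^sub>0 nat) \<Rightarrow>\<^sub>0 'b)"
  where "euler_poly i = Poly_Mapping.mapp (\<lambda>\<alpha> c. of_nat (Poly_Mapping.lookup \<alpha> i) * c)"

lemma lookup_euler_poly:
  "Poly_Mapping.lookup (euler_poly i p) \<alpha> = of_nat (Poly_Mapping.lookup \<alpha> i) * Poly_Mapping.lookup p \<alpha>"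
  by (auto simp: euler_poly_def lookup_mapp when_def in_keys_iff)

lemma euler_poly_add: "euler_poly i (p + q) = euler_poly i p + euler_poly i q"
  by (intro poly_mapping_eqI) (simp add: lookup_euler_poly lookup_add distrib_left)

lemma euler_poly_single:
  "euler_poly i (Poly_Mapping.single \<alpha> c) = Poly_Mapping.single \<alpha> (of_nat (Poly_Mapping.lookup \<alpha> i) * c)"
  by (intro poly_mapping_eqI) (simp add: lookup_euler_poly lookup_single when_def)

lemma euler_poly_mult: "euler_poly i (p * q) = euler_poly i p * q + p * euler_poly i q"
proof (induction p rule: poly_mapping_induct_add)
  case (single \<alpha> c)
  show ?case
  proof (induction q rule: poly_mapping_induct_add)
    case (single \<beta> d)
    show ?case
      by (simp add: mult_single euler_poly_single lookup_add algebra_simps flip: single_add)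
  next
    case (add p q)
    then show ?case
      by (simp add: euler_poly_add algebra_simps)
  qed
next
  case (add p q)
  then show ?case
    by (simp add: euler_poly_add algebra_simps)
qed

text \<open>
  The extension of a derivation \<open>d\<close> of an integral domain to its field of fractions. The
  description denotes only when the right-hand side is independent of the
  representation \<open>f = p/q\<close>, which the Leibniz rule for \<open>d\<close> guarantees.
\<close>

definition quotient_rule :: "('a::idom \<Rightarrow> 'a) \<Rightarrow> 'a fract \<Rightarrow> 'a fract"
  where "quotient_rule d f =
    (THE g. \<exists>p q. q \<noteq> 0 \<and> f = Fract p q \<and> g = Fract (d p * q - p * d q) (q * q))"

lemma quotient_rule_Fract:
  assumes d: "\<And>a b. d (a * b) = d a * b + a * d b" and "q \<noteq> 0"
  shows "quotient_rule d (Fract p q) = Fract (d p * q - p * d q) (q * q)"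
  unfolding quotient_rule_def
proof (rule the_equality)
  show "\<exists>p' q'. q' \<noteq> 0 \<and> Fract p q = Fract p' q' \<and>
      Fract (d p * q - p * d q) (q * q) = Fract (d p' * q' - p' * d q') (q' * q')"
    using \<open>q \<noteq> 0\<close> by blast
  fix g
  assume "\<exists>p' q'. q' \<noteq> 0 \<and> Fract p q = Fract p' q' \<and> g = Fract (d p' * q' - p' * d q') (q' * q')"
  then obtain p' q' where q': "q' \<noteq> 0" "Fract p q = Fract p' q'"
    and g: "g = Fract (d p' * q' - p' * d q') (q' * q')"
    by blast
  have eq: "p * q' = p' * q"
    using q' \<open>q \<noteq> 0\<close> by (simp add: eq_fract)
  then have d_eq: "d p * q' + p * d q' = d p' * q + p' * d q"
    by (simp flip: d)
  have "(d p' * q' - p' * d q') * (q * q) =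
      (d p' * q + p' * d q) * (q * q') - p' * q * (d q * q') - p' * q * (d q' * q)"
    by (simp add: algebra_simps)
  also have "\<dots> = (d p * q' + p * d q') * (q * q') - p * q' * (d q * q') - p * q' * (d q' * q)"
    by (simp only: eq d_eq)
  also have "\<dots> = (d p * q - p * d q) * (q' * q')"
    by (simp add: algebra_simps)
  finally have "(d p' * q' - p' * d q') * (q * q) = (d p * q - p * d q) * (q' * q')" .
  then show "g = Fract (d p * q - p * d q) (q * q)"
    using q'(1) \<open>q \<noteq> 0\<close> by (simp add: g eq_fract)
qed

definition euler :: "'n::finite mod_ring \<Rightarrow> 'n ratfun \<Rightarrow> 'n ratfun"
  where "euler i = quotient_rule (euler_poly i)"

lemma euler_Fract:
  "q \<noteq> 0 \<Longrightarrow> euler i (Fract p q) = Fract (euler_poly i p * q - p * euler_poly i q) (q * q)"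
  by (simp add: euler_def quotient_rule_Fract euler_poly_mult)

lemma euler_poly_1: "euler_poly i 1 = 0"
  using euler_poly_single[of i 0 1] by simp

lemma euler_B: "euler i (B j) = (if i = j then B j else 0)"
  by (simp add: B_def euler_Fract euler_poly_single euler_poly_1 lookup_single fract_collapse)

lemma derivation_euler: "derivation (euler i)"
  unfolding derivation_def
proof (intro conjI allI)
  fix f g :: "'a ratfun"
  obtain a b where f: "f = Fract a b" "b \<noteq> 0"
    by (cases f)
  obtain c d where g: "g = Fract c d" "d \<noteq> 0"
    by (cases g)
  show "euler i (f + g) = euler i f + euler i g"
    using f(2) g(2)
    by (simp add: f(1) g(1) euler_Fract eq_fract euler_poly_add euler_poly_mult algebra_simps)
  show "euler i (f * g) = euler i f * g + f * euler i g"
    using f(2) g(2)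
    by (simp add: f(1) g(1) euler_Fract eq_fract euler_poly_mult algebra_simps)
next
  fix c and f :: "'a ratfun"
  obtain a b where f: "f = Fract a b" "b \<noteq> 0"
    by (cases f)
  show "euler i (const c * f) = const c * euler i f"
    using f(2)
    by (simp add: f(1) const_def euler_Fract eq_fract euler_poly_mult euler_poly_single algebra_simps)
qed

section \<open>Biderivations and their Jacobiator\<close>

lemma derivation_bracket_left:
  assumes "antisymmetric_biderivation br"
  shows "derivation (\<lambda>f. br f g)"
  using assms
  by (auto simp: antisymmetric_biderivation_def real_bilinear_def leibniz_def derivation_def)

lemma derivation_bracket_right:
  assumes "antisymmetric_biderivation br"
  shows "derivation (br f)"
  using assms
  by (auto simp: antisymmetric_biderivation_def real_bilinear_def leibniz_def derivation_def)

lemma bracket_swap: "antisymmetric_biderivation br \<Longrightarrow> br f g = - br g f"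
  unfolding antisymmetric_biderivation_def antisymmetric_def by blast

lemma antisymmetric_biderivation_eqI:
  assumes br: "antisymmetric_biderivation br" and br': "antisymmetric_biderivation br'"
    and gen: "\<And>i j. br (B i) (B j) = br' (B i) (B j)"
  shows "br = br'"
proof (intro ext)
  fix f g
  have "br (B i) g = br' (B i) g" for i
    by (rule derivation_eqI[where D = "br (B i)" and D' = "br' (B i)"])
      (rule derivation_bracket_right br br' gen)+
  then show "br f g = br' f g"
    using derivation_eqI[OF derivation_bracket_left[OF br] derivation_bracket_left[OF br']]
    by blast
qed

definition jacobiator :: "'n::finite bracket \<Rightarrow> 'n ratfun \<Rightarrow> 'n ratfun \<Rightarrow> 'n ratfun \<Rightarrow> 'n ratfun"
  where "jacobiator br f g h = br f (br g h) + br g (br h f) + br h (br f g)"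

lemma jacobiator_rotate: "jacobiator br f g h = jacobiator br g h f"
  by (simp add: jacobiator_def add_ac)

text \<open>
  Expanding the Jacobiator of \<open>a b\<close>, \<open>g\<close>, \<open>h\<close> by the Leibniz rule leaves, apart from the wanted
  terms, products of two first-order brackets such as \<open>{h,a} {g,b} + {h,a} {b,g}\<close>, which cancel
  by antisymmetry.
\<close>

lemma derivation_jacobiator:
  assumes br: "antisymmetric_biderivation br"
  shows "derivation (\<lambda>f. jacobiator br f g h)"
proof -
  note left = derivation_bracket_left[OF br] and right = derivation_bracket_right[OF br]
  have mult: "jacobiator br (a * b) g h = jacobiator br a g h * b + a * jacobiator br b g h" for a b
  proof -
    have "br b g = - br g b" "br a g = - br g a"
      using bracket_swap[OF br] by blast+
    then show ?thesis
      by (simp add: jacobiator_def derivation_mult[OF left] derivation_mult[OF right]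
          derivation_add[OF left] derivation_add[OF right] derivation_diff[OF right]
          derivation_uminus[OF right] algebra_simps)
  qed
  show ?thesis
    unfolding derivation_def
    by (intro conjI allI mult)
      (simp_all add: jacobiator_def derivation_add[OF left] derivation_add[OF right]
        derivation_mult[OF left] derivation_mult[OF right]
        derivation_const[OF left] derivation_const[OF right] distrib_left)
qed

text \<open>
  The Jacobiator is a derivation in its first argument and invariant under rotation, so the
  three arguments can be freed from being generators one after the other.
\<close>

lemma jacobi_if_jacobi_on_generators:
  assumes br: "antisymmetric_biderivation br"
    and gen: "\<And>i j k. jacobiator br (B i) (B j) (B k) = 0"
  shows "jacobi br"
proof -
  note vanish = derivation_eq_0_if_zero_on_generators[OF derivation_jacobiator[OF br]]
  have 1: "jacobiator br f (B j) (B k) = 0" for f j k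
    by (rule vanish) (rule gen)
  have 2: "jacobiator br g (B k) f = 0" for f g k
    by (rule vanish) (subst jacobiator_rotate[symmetric], rule 1)
  have "jacobiator br h f g = 0" for f g h
    by (rule vanish) (subst jacobiator_rotate[symmetric], rule 2)
  then show ?thesis
    by (simp add: jacobi_def jacobiator_def)
qed

section \<open>Brackets with prescribed logarithmic coefficients\<close>

text \<open>
  The bracket with \<open>{ln B\<^sub>i, ln B\<^sub>j} = P i j\<close>: the Euler derivation \<open>B\<^sub>i \<cdot> \<partial>/\<partial>B\<^sub>i\<close> is the partial
  derivative with respect to \<open>ln B\<^sub>i\<close>.
\<close>

definition log_bracket :: "('n::finite mod_ring \<Rightarrow> 'n mod_ring \<Rightarrow> 'n ratfun) \<Rightarrow> 'n bracket"
  where "log_bracket P f g = (\<Sum>i\<in>UNIV. \<Sum>j\<in>UNIV. P i j * euler i f * euler j g)"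

lemma log_bracket_B: "log_bracket P (B i) (B j) = P i j * B i * B j"
proof -
  have "log_bracket P (B i) (B j) =
      (\<Sum>k\<in>UNIV. \<Sum>l\<in>UNIV. if l = j then (if k = i then P k l * B i * B j else 0) else 0)"
    unfolding log_bracket_def by (intro sum.cong refl) (simp add: euler_B)
  then show ?thesis
    by simp
qed

lemma antisymmetric_biderivation_log_bracket:
  assumes "\<And>i j. P i j = - P j i"
  shows "antisymmetric_biderivation (log_bracket P)"
proof -
  have "log_bracket P f g = - log_bracket P g f" for f g
  proof -
    have "log_bracket P f g = (\<Sum>j\<in>UNIV. \<Sum>i\<in>UNIV. P i j * euler i f * euler j g)"
      unfolding log_bracket_def by (rule sum.swap)
    also have "\<dots> = (\<Sum>j\<in>UNIV. \<Sum>i\<in>UNIV. - (P j i * euler j g * euler i f))"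
      by (intro sum.cong refl) (subst assms, simp)
    also have "\<dots> = - log_bracket P g f"
      by (simp add: log_bracket_def sum_negf)
    finally show ?thesis .
  qed
  moreover have "real_bilinear (log_bracket P)"
    unfolding real_bilinear_def
  proof (intro conjI allI)
    fix f g h :: "'a ratfun" and c
    show "log_bracket P (f + g) h = log_bracket P f h + log_bracket P g h"
      and "log_bracket P f (g + h) = log_bracket P f g + log_bracket P f h"
      by (simp_all add: log_bracket_def derivation_add[OF derivation_euler] distrib_left
          distrib_right sum.distrib)
    show "log_bracket P (const c * f) g = const c * log_bracket P f g"
      and "log_bracket P f (const c * g) = const c * log_bracket P f g"
      by (simp_all add: log_bracket_def derivation_mult[OF derivation_euler]
          derivation_const[OF derivation_euler] sum_distrib_left mult_ac)
  qed
  moreover have "leibniz (log_bracket P)"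
    unfolding leibniz_def log_bracket_def derivation_mult[OF derivation_euler] sum_distrib_left
      sum_distrib_right sum.distrib[symmetric]
    by (intro conjI allI sum.cong refl) (simp_all add: algebra_simps)
  ultimately show ?thesis
    unfolding antisymmetric_biderivation_def antisymmetric_def by blast
qed

lemma log_bracket_add_scale:
  "log_bracket P f g + c * log_bracket Q f g = log_bracket (\<lambda>i j. P i j + c * Q i j) f g"
  by (simp add: log_bracket_def sum_distrib_left algebra_simps flip: sum.distrib)

text \<open>
  Here \<open>R i j k\<close> stands for \<open>{ln B\<^sub>i, P j k}\<close>. The Leibniz rule also produces the products
  \<open>P j k * (P i j + P i k)\<close>, but their cyclic sum vanishes by antisymmetry of \<open>P\<close>. Thus the Jacobi
  identity on generators becomes linear in the derivatives of the coefficients.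
\<close>

lemma jacobiator_B:
  assumes br: "antisymmetric_biderivation br"
    and P: "\<And>i j. br (B i) (B j) = P i j * B i * B j"
    and R: "\<And>i j k. br (B i) (P j k) = B i * R i j k"
  shows "jacobiator br (B i) (B j) (B k) = B i * B j * B k * (R i j k + R j k i + R k i j)"
proof -
  note right = derivation_bracket_right[OF br]
  have P_swap: "P i j = - P j i" for i j
  proof -
    have "P i j * (B i * B j) = - P j i * (B i * B j)"
      using bracket_swap[OF br, of "B i" "B j"] by (simp add: P mult_ac)
    moreover have "B i * B j \<noteq> 0"
      by simp
    ultimately show ?thesis
      by (simp only: mult_right_cancel simp_thms)
  qed
  have inner: "br (B i) (P j k * B j * B k) =
      B i * B j * B k * (R i j k + P j k * P i j + P j k * P i k)" for i j k
    by (simp add: derivation_mult[OF right] P R algebra_simps)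
  show ?thesis
    unfolding jacobiator_def P inner
    using P_swap[of i j] P_swap[of j k] P_swap[of k i] by (simp add: algebra_simps)
qed

section \<open>The coefficients of the two brackets\<close>

abbreviation wedge :: "'n mod_ring \<Rightarrow> 'n mod_ring \<Rightarrow> 'n mod_ring \<Rightarrow> 'n mod_ring \<Rightarrow> 'n::finite ratfun"
  where "wedge a b i j \<equiv> kronecker_delta a i * kronecker_delta b j - kronecker_delta b i * kronecker_delta a j"

definition neighbour_form :: "'n::nontriv mod_ring \<Rightarrow> 'n mod_ring \<Rightarrow> 'n ratfun"
  where "neighbour_form i j = kronecker_delta (i + 1) j - kronecker_delta (i - 1) j"

definition triple_form :: "'n::nontriv mod_ring \<Rightarrow> 'n mod_ring \<Rightarrow> 'n mod_ring \<Rightarrow> 'n ratfun"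
  where "triple_form m i j = wedge (m - 1) m i j + wedge m (m + 1) i j + wedge (m - 1) (m + 1) i j"

text \<open>
  Since \<open>neighbour_form\<close> consists of the coefficients of the second bracket, changing \<open>c\<close> moves along
  the pencil; \<open>c = 1\<close> is the first bracket. The sum runs over the
  variables \<open>1/B\<^sub>m\<close>, not over pairs of indices, because the coefficient of each of them is a
  sum of wedges, and in this shape the Jacobi identity is an identity of exterior algebra.
\<close>

definition log_coeff :: "'n ratfun \<Rightarrow> 'n::nontriv mod_ring \<Rightarrow> 'n mod_ring \<Rightarrow> 'n ratfun"
  where "log_coeff c i j = c * neighbour_form i j - (\<Sum>m\<in>UNIV. triple_form m i j * inverse (B m))"

lemma mod_ring_numeral_neq_0:
  assumes "CARD('n::nontriv) \<ge> 5"
  shows "(2 :: 'n mod_ring) \<noteq> 0" "(3 :: 'n mod_ring) \<noteq> 0" "(4 :: 'n mod_ring) \<noteq> 0"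
proof -
  have neq: "of_nat k \<noteq> (0 :: 'n mod_ring)" if "0 < k" "k < 5" for k
    using that assms by (auto simp: of_nat_eq_0_iff_char_dvd dest: dvd_imp_le)
  show "(2 :: 'n mod_ring) \<noteq> 0" "(3 :: 'n mod_ring) \<noteq> 0" "(4 :: 'n mod_ring) \<noteq> 0"
    using neq[of 2] neq[of 3] neq[of 4] by simp_all
qed

lemma neighbour_form_swap: "neighbour_form i j = - neighbour_form j i"
  by (auto simp: neighbour_form_def kronecker_delta_def)

lemma triple_form_swap: "triple_form m i j = - triple_form m j i"
  by (simp add: triple_form_def)

lemma log_coeff_swap: "log_coeff c i j = - log_coeff c j i"
  unfolding log_coeff_def
  by (subst neighbour_form_swap, subst triple_form_swap) (simp add: sum_negf)

text \<open>
  Sorting the same sum by pairs of indices: neighbours \<open>i\<close>, \<open>i + 1\<close> both contribute to their own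
  coefficient, while the pair \<open>i\<close>, \<open>i + 2\<close> sees only the index between them.
\<close>

lemma sum_triple_form:
  "(\<Sum>m\<in>UNIV. triple_form m i j * x m) =
     kronecker_delta (i + 1) j * (x i + x j) + kronecker_delta (i + 2) j * x (i + 1)
   - kronecker_delta (j + 1) i * (x i + x j) - kronecker_delta (j + 2) i * x (j + 1)"
proof -
  have 1: "(\<Sum>m\<in>UNIV. kronecker_delta (m - 1) a * (kronecker_delta m b * x m)) =
      kronecker_delta (a + 1) b * x b" for a b
  proof -
    have "(\<Sum>m\<in>UNIV. kronecker_delta (m - 1) a * (kronecker_delta m b * x m)) =
        (\<Sum>m\<in>UNIV. if m = b then kronecker_delta (a + 1) b * x b else 0)"
      by (intro sum.cong refl) (auto simp: kronecker_delta_def algebra_simps)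
    then show ?thesis by simp
  qed
  have 2: "(\<Sum>m\<in>UNIV. kronecker_delta (m + 1) b * (kronecker_delta m a * x m)) =
      kronecker_delta (a + 1) b * x a" for a b
  proof -
    have "(\<Sum>m\<in>UNIV. kronecker_delta (m + 1) b * (kronecker_delta m a * x m)) =
        (\<Sum>m\<in>UNIV. if m = a then kronecker_delta (a + 1) b * x a else 0)"
      by (intro sum.cong refl) (auto simp: kronecker_delta_def)
    then show ?thesis by simp
  qed
  have 3: "(\<Sum>m\<in>UNIV. kronecker_delta (m - 1) a * (kronecker_delta (m + 1) b * x m)) =
      kronecker_delta (a + 2) b * x (a + 1)" for a b
  proof -
    have "(\<Sum>m\<in>UNIV. kronecker_delta (m - 1) a * (kronecker_delta (m + 1) b * x m)) =
        (\<Sum>m\<in>UNIV. if m = a + 1 then kronecker_delta (a + 2) b * x (a + 1) else 0)"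
      by (intro sum.cong refl) (auto simp: kronecker_delta_def algebra_simps)
    then show ?thesis by simp
  qed
  have "(\<Sum>m\<in>UNIV. triple_form m i j * x m) =
      (\<Sum>m\<in>UNIV. kronecker_delta (m - 1) i * (kronecker_delta m j * x m))
    - (\<Sum>m\<in>UNIV. kronecker_delta (m - 1) j * (kronecker_delta m i * x m))
    + (\<Sum>m\<in>UNIV. kronecker_delta (m + 1) j * (kronecker_delta m i * x m))
    - (\<Sum>m\<in>UNIV. kronecker_delta (m + 1) i * (kronecker_delta m j * x m))
    + (\<Sum>m\<in>UNIV. kronecker_delta (m - 1) i * (kronecker_delta (m + 1) j * x m))
    - (\<Sum>m\<in>UNIV. kronecker_delta (m - 1) j * (kronecker_delta (m + 1) i * x m))"
    unfolding sum.distrib[symmetric] sum_subtractf[symmetric]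
    by (intro sum.cong refl) (simp add: triple_form_def algebra_simps)
  then show ?thesis
    by (simp only: 1 2 3) (simp add: algebra_simps)
qed

lemma log_coeff_eq:
  "log_coeff c i j =
     kronecker_delta (i + 1) j * (c - inverse (B i) - inverse (B j))
   - kronecker_delta (i + 2) j * inverse (B (i + 1))
   - kronecker_delta (j + 1) i * (c - inverse (B i) - inverse (B j))
   + kronecker_delta (j + 2) i * inverse (B (j + 1))"
proof -
  have "kronecker_delta (i - 1) j = kronecker_delta (j + 1) i"
    by (auto simp: kronecker_delta_def)
  then show ?thesis
    by (simp only: log_coeff_def neighbour_form_def sum_triple_form) (simp add: algebra_simps)
qed

lemma bracket_S2_eq: "bracket_S2 = (log_bracket neighbour_form :: 'n::nontriv bracket)"
  unfolding bracket_S2_def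
proof (rule the_equality)
  show S2: "antisymmetric_biderivation (log_bracket neighbour_form :: 'n bracket) \<and>
    (\<forall>i j. log_bracket neighbour_form (B i) (B j) =
      (kronecker_delta (i + 1) j - kronecker_delta (i - 1) j) * B i * (B j :: 'n ratfun))"
    using antisymmetric_biderivation_log_bracket[of neighbour_form] neighbour_form_swap
    by (auto simp: log_bracket_B neighbour_form_def)
  fix br :: "'n bracket"
  assume "antisymmetric_biderivation br \<and>
    (\<forall>i j. br (B i) (B j) = (kronecker_delta (i + 1) j - kronecker_delta (i - 1) j) * B i * B j)"
  then show "br = log_bracket neighbour_form"
    using S2 by (intro antisymmetric_biderivation_eqI) auto
qed

text \<open>
  For \<open>N \<ge> 5\<close> the steps \<open>1, 2, -1, -2\<close> are distinct and nonzero, so at most one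
  term of the coefficient formula is present for each pair of indices and the
  prescribed values do not interfere with each other.
\<close>

lemma bracket_C2_eq:
  assumes N: "CARD('n::nontriv) \<ge> 5"
  shows "bracket_C2 = (log_bracket (log_coeff 1) :: 'n bracket)"
  unfolding bracket_C2_def
proof (rule the_equality)
  note nz = mod_ring_numeral_neq_0[OF N]
  have eqs: "k + 1 + 1 \<noteq> k" "k + 1 + 2 \<noteq> k" "k + 2 + 1 \<noteq> k" "k + 2 + 2 \<noteq> k" for k :: "'n mod_ring"
    using nz by (simp_all add: add.assoc)
  have two_neq_1: "(2 :: 'n mod_ring) \<noteq> 1"
    by (metis add_cancel_right_right one_add_one zero_neq_one)
  let ?br = "log_bracket (log_coeff 1) :: 'n bracket"
  show C2: "antisymmetric_biderivation ?br \<and>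
    (\<forall>k. ?br (B k) (B (k + 1)) = (1 - 1 / B k - 1 / B (k + 1)) * B k * B (k + 1)) \<and>
    (\<forall>k. ?br (B k) (B (k + 2)) = - (B k * B (k + 2) / B (k + 1))) \<and>
    (\<forall>i j. i - j \<notin> {1, -1, 2, -2} \<longrightarrow> ?br (B i) (B j) = 0)"
  proof (intro conjI allI impI)
    show "antisymmetric_biderivation ?br"
      by (intro antisymmetric_biderivation_log_bracket log_coeff_swap)
    show "?br (B k) (B (k + 1)) = (1 - 1 / B k - 1 / B (k + 1)) * B k * B (k + 1)" for k
      using eqs two_neq_1 by (simp add: log_bracket_B log_coeff_eq kronecker_delta_def inverse_eq_divide)
    show "?br (B k) (B (k + 2)) = - (B k * B (k + 2) / B (k + 1))" for k
      using eqs two_neq_1 by (simp add: log_bracket_B log_coeff_eq kronecker_delta_def inverse_eq_divide)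
    fix i j :: "'n mod_ring"
    assume "i - j \<notin> {1, -1, 2, -2}"
    then have "i + 1 \<noteq> j" "i + 2 \<noteq> j" "j + 1 \<noteq> i" "j + 2 \<noteq> i"
      by auto
    then show "?br (B i) (B j) = 0"
      by (simp add: log_bracket_B log_coeff_eq kronecker_delta_def)
  qed
  fix br :: "'n bracket"
  assume br: "antisymmetric_biderivation br \<and>
    (\<forall>k. br (B k) (B (k + 1)) = (1 - 1 / B k - 1 / B (k + 1)) * B k * B (k + 1)) \<and>
    (\<forall>k. br (B k) (B (k + 2)) = - (B k * B (k + 2) / B (k + 1))) \<and>
    (\<forall>i j. i - j \<notin> {1, -1, 2, -2} \<longrightarrow> br (B i) (B j) = 0)"
  show "br = ?br"
  proof (rule antisymmetric_biderivation_eqI)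
    show abr: "antisymmetric_biderivation br" and aC2: "antisymmetric_biderivation ?br"
      using br C2 by blast+
    have forward: "br (B k) (B (k + 1)) = ?br (B k) (B (k + 1))"
        "br (B k) (B (k + 2)) = ?br (B k) (B (k + 2))" for k
      using br C2 by simp_all
    have backward: "br (B (k + 1)) (B k) = ?br (B (k + 1)) (B k)"
        "br (B (k + 2)) (B k) = ?br (B (k + 2)) (B k)" for k
      using forward bracket_swap[OF abr] bracket_swap[OF aC2] by metis+
    fix i j :: "'n mod_ring"
    consider "i - j \<notin> {1, -1, 2, -2}" | "j = i + 1" | "i = j + 1" | "j = i + 2" | "i = j + 2"
      by (auto simp: algebra_simps eq_neg_iff_add_eq_0)
    then show "br (B i) (B j) = ?br (B i) (B j)"
      using br C2 by cases (simp_all add: forward backward)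
  qed
qed

section \<open>The Jacobi identity for the pencil\<close>

text \<open>
  As a linear form in \<open>i\<close>, \<open>neighbour_form i m\<close> is \<open>e\<^sub>m\<^sub>-\<^sub>1 - e\<^sub>m\<^sub>+\<^sub>1\<close>. In its wedge product with
  \<open>triple_form m\<close> the summand \<open>e\<^sub>m\<^sub>-\<^sub>1 \<and> e\<^sub>m\<^sub>+\<^sub>1\<close> drops out, and the other two summands give
  \<open>e\<^sub>m\<^sub>-\<^sub>1 \<and> e\<^sub>m \<and> e\<^sub>m\<^sub>+\<^sub>1\<close> with opposite signs.
\<close>

lemma wedge_triple_neighbour:
  "triple_form m j k * neighbour_form i m + triple_form m k i * neighbour_form j m
    + triple_form m i j * neighbour_form k m = 0"
proof -
  have contraction: "neighbour_form a m = kronecker_delta (m - 1) a - kronecker_delta (m + 1) a" for a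
    by (auto simp: neighbour_form_def kronecker_delta_def)
  show ?thesis
    unfolding contraction triple_form_def by (simp add: algebra_simps)
qed

text \<open>
  The form \<open>triple_form p\<close> contracted with \<open>m\<close> is zero unless \<open>m\<close> is \<open>p\<close> or one of its two
  neighbours. For \<open>m = p\<close> the contraction is again \<open>e\<^sub>m\<^sub>-\<^sub>1 - e\<^sub>m\<^sub>+\<^sub>1\<close>, and \<open>Q m m\<close> vanishes by itself as
  in \<open>wedge_triple_neighbour\<close>. For neighbours \<open>p = m + 1\<close> neither summand vanishes, but each of the
  wedge products of three of the consecutive \<open>e\<^sub>m\<^sub>-\<^sub>1, \<dots>, e\<^sub>m\<^sub>+\<^sub>2\<close> occurs in both, with opposite
  signs.
\<close>

lemma wedge_triple_triple:
  fixes m p i j k :: "'n::nontriv mod_ring"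
  assumes N: "CARD('n) \<ge> 5"
  defines "Q \<equiv> \<lambda>m p. triple_form m j k * triple_form p i m + triple_form m k i * triple_form p j m
    + triple_form m i j * triple_form p k m"
  shows "Q m p + Q p m = 0"
proof -
  note nz = mod_ring_numeral_neq_0[OF N]
  have eqs: "a - 1 \<noteq> a + 1" "a + 1 \<noteq> a - 1" "a + 1 + 1 \<noteq> a" for a :: "'n mod_ring"
    using nz by (simp_all add: algebra_simps)
  have same: "triple_form m a m = kronecker_delta (m - 1) a - kronecker_delta (m + 1) a" for a m :: "'n mod_ring"
    using eqs by (simp add: triple_form_def kronecker_delta_def)
  have up: "triple_form (m + 1) a m = - kronecker_delta (m + 1) a - kronecker_delta (m + 1 + 1) a" for a m :: "'n mod_ring"
    using eqs by (simp add: triple_form_def kronecker_delta_def)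
  have down: "triple_form m a (m + 1) = kronecker_delta m a + kronecker_delta (m - 1) a" for a m :: "'n mod_ring"
    using eqs by (simp add: triple_form_def kronecker_delta_def)
  have far: "triple_form p a m = 0" if "m \<noteq> p" "m \<noteq> p + 1" "p \<noteq> m + 1" for a m p :: "'n mod_ring"
    using that by (auto simp: triple_form_def kronecker_delta_def)
  have diagonal: "Q m m = 0" for m
    unfolding Q_def same unfolding triple_form_def by (simp add: algebra_simps)
  have adjacent: "Q m (m + 1) + Q (m + 1) m = 0" for m
    unfolding Q_def up down unfolding triple_form_def by (simp add: algebra_simps)
  consider "p = m" | "p = m + 1" | "m = p + 1" | "m \<noteq> p" "m \<noteq> p + 1" "p \<noteq> m + 1"
    by blast
  then show ?thesis
  proof cases
    case 3
    then show ?thesis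
      using adjacent[of p] by (simp add: add.commute)
  next
    case 4
    then show ?thesis
      unfolding Q_def by (simp add: far)
  qed (use diagonal adjacent in simp_all)
qed

lemma derivation_kronecker_delta: "derivation D \<Longrightarrow> D (kronecker_delta i j) = 0"
  by (simp add: kronecker_delta_def derivation_0 derivation_1)

lemma derivation_neighbour_form: "derivation D \<Longrightarrow> D (neighbour_form i j) = 0"
  by (simp add: neighbour_form_def derivation_diff derivation_kronecker_delta)

lemma derivation_triple_form: "derivation D \<Longrightarrow> D (triple_form m i j) = 0"
  by (simp add: triple_form_def derivation_add derivation_diff derivation_mult derivation_kronecker_delta)

text \<open>
  The forms are constants, so only the factors \<open>1/B\<^sub>m\<close> are differentiated; in logarithmic
  coordinates \<open>{u\<^sub>i, 1/B\<^sub>m} = - P i m / B\<^sub>m\<close>, whose sign cancels the one in \<open>log_coeff\<close>.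
\<close>

lemma bracket_B_log_coeff:
  fixes c :: real
  defines "P \<equiv> log_coeff (const c)"
  shows "log_bracket P (B i) (P j k) = B i * (\<Sum>m\<in>UNIV. triple_form m j k * P i m * inverse (B m))"
proof -
  have br: "antisymmetric_biderivation (log_bracket P)"
    unfolding P_def by (intro antisymmetric_biderivation_log_bracket log_coeff_swap)
  note right = derivation_bracket_right[OF br]
  have inverse_B: "log_bracket P (B i) (inverse (B m)) = - (B i * P i m * inverse (B m))" for m
    unfolding derivation_inverse[OF right B_nonzero] log_bracket_B by (simp add: field_simps)
  have "log_bracket P (B i) (P j k) = - (\<Sum>m\<in>UNIV. triple_form m j k * log_bracket P (B i) (inverse (B m)))"
    by (subst (2) P_def) (simp add: log_coeff_def derivation_diff[OF right] derivation_mult[OF right]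
        derivation_sum[OF right] derivation_triple_form[OF right] derivation_neighbour_form[OF right]
        derivation_const[OF right])
  also have "\<dots> = - (\<Sum>m\<in>UNIV. triple_form m j k * - (B i * P i m * inverse (B m)))"
    by (simp only: inverse_B)
  also have "\<dots> = B i * (\<Sum>m\<in>UNIV. triple_form m j k * P i m * inverse (B m))"
    by (simp add: sum_distrib_left sum_negf mult_ac)
  finally show ?thesis .
qed

lemma sum_sum_eq_0_if_alternating:
  fixes x :: "'a \<Rightarrow> 'a \<Rightarrow> 'b::idom"
  assumes "\<And>m p. x m p + x p m = 0" and "(2 :: 'b) \<noteq> 0"
  shows "(\<Sum>m\<in>A. \<Sum>p\<in>A. x m p) = 0"
proof -
  have "(\<Sum>m\<in>A. \<Sum>p\<in>A. x m p) + (\<Sum>m\<in>A. \<Sum>p\<in>A. x p m) = 0"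
    by (simp add: assms(1) flip: sum.distrib)
  moreover have "(\<Sum>m\<in>A. \<Sum>p\<in>A. x p m) = (\<Sum>m\<in>A. \<Sum>p\<in>A. x m p)"
    by (rule sum.swap)
  ultimately show ?thesis
    using assms(2) by (simp flip: mult_2)
qed

lemma poisson_bracket_pencil:
  assumes N: "CARD('n::nontriv) \<ge> 5"
  shows "poisson_bracket (log_bracket (log_coeff (const c)) :: 'n bracket)"
proof -
  define P :: "'n mod_ring \<Rightarrow> 'n mod_ring \<Rightarrow> 'n ratfun" where "P = log_coeff (const c)"
  define R where "R i j k = (\<Sum>m\<in>UNIV. triple_form m j k * P i m * inverse (B m))" for i j k
  have br: "antisymmetric_biderivation (log_bracket P)"
    unfolding P_def by (intro antisymmetric_biderivation_log_bracket log_coeff_swap)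
  have "R i j k + R j k i + R k i j = 0" for i j k
  proof -
    (* The coefficients of the products of inverses; only their symmetric part contributes. *)
    define Q where "Q m p = triple_form m j k * triple_form p i m + triple_form m k i * triple_form p j m
      + triple_form m i j * triple_form p k m" for m p
    have cyclic: "triple_form m j k * P i m + triple_form m k i * P j m + triple_form m i j * P k m
        = - (\<Sum>p\<in>UNIV. Q m p * inverse (B p))" for m
    proof -
      have "triple_form m j k * P i m + triple_form m k i * P j m + triple_form m i j * P k m
        = const c * (triple_form m j k * neighbour_form i m + triple_form m k i * neighbour_form j m
            + triple_form m i j * neighbour_form k m) - (\<Sum>p\<in>UNIV. Q m p * inverse (B p))"
        by (simp add: P_def log_coeff_def Q_def algebra_simps sum.distrib sum_distrib_left)
      then show ?thesis
        by (simp add: wedge_triple_neighbour)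
    qed
    have "R i j k + R j k i + R k i j = (\<Sum>m\<in>UNIV. (triple_form m j k * P i m
        + triple_form m k i * P j m + triple_form m i j * P k m) * inverse (B m))"
      by (simp add: R_def algebra_simps sum.distrib)
    also have "\<dots> = - (\<Sum>m\<in>UNIV. \<Sum>p\<in>UNIV. Q m p * inverse (B p) * inverse (B m))"
      unfolding cyclic by (simp add: sum_negf sum_distrib_right)
    also have "(\<Sum>m\<in>UNIV. \<Sum>p\<in>UNIV. Q m p * inverse (B p) * inverse (B m)) = 0"
    proof (rule sum_sum_eq_0_if_alternating)
      fix m p
      have "Q m p * inverse (B p) * inverse (B m) + Q p m * inverse (B m) * inverse (B p)
          = (Q m p + Q p m) * inverse (B m) * inverse (B p)"
        by (simp add: algebra_simps)
      then show "Q m p * inverse (B p) * inverse (B m) + Q p m * inverse (B m) * inverse (B p) = 0"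
        using wedge_triple_triple[OF N, of m j k p i] by (simp add: Q_def)
    qed (rule two_nonzero)
    finally show ?thesis
      by simp
  qed
  moreover have "log_bracket P (B i) (P j k) = B i * R i j k" for i j k
    unfolding P_def R_def by (rule bracket_B_log_coeff)
  ultimately have "jacobi (log_bracket P)"
    by (intro jacobi_if_jacobi_on_generators[OF br]) (simp add: jacobiator_B[OF br log_bracket_B])
  with br show ?thesis
    by (simp add: poisson_bracket_def antisymmetric_biderivation_def P_def)
qed

theorem theorem1p2:
  assumes "CARD('n::nontriv) \<ge> 5"
  shows "compatible (bracket_C2 :: 'n bracket) bracket_S2"
  unfolding compatible_def
proof (intro allI)
  fix c :: real
  have "log_coeff 1 i j + const c * neighbour_form i j = log_coeff (const (1 + c)) i j"
    for i j :: "'n mod_ring"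
  proof -
    have "const (1 + c) = 1 + (const c :: 'n ratfun)"
      by (simp add: const_def One_fract_def single_add)
    then show ?thesis
      by (simp add: log_coeff_def algebra_simps)
  qed
  then have "(\<lambda>f g. bracket_C2 f g + const c * bracket_S2 f g)
      = (log_bracket (log_coeff (const (1 + c))) :: 'n bracket)"
    by (simp add: bracket_C2_eq[OF assms] bracket_S2_eq log_bracket_add_scale)
  then show "poisson_bracket (\<lambda>f g. (bracket_C2 :: 'n bracket) f g + const c * bracket_S2 f g)"
    using poisson_bracket_pencil[OF assms] by simp
qed

end
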